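(* Let $0=t_0<t_1<\dots<t_N=T$, let $\Omega=C([0,T];\mathbb{R}^d)$ with canonical process $X=(X_t)_{0\le t\le T}$ and canonical filtration $\mathcal F=(\mathcal F_t)_{0\le t\le T}$, and let $\Pi:\Omega\to(\mathbb{R}^d)^{N+1}$, $\Pi(\omega)=(X_{t_0}(\omega),\dots,X_{t_N}(\omega))$. Let $R$ be an arbitrary probability measure on $\Omega$, let $r:=R\circ\Pi^{-1}$, and let $\mu$ be a probability measure on $(\mathbb{R}^d)^{N+1}$ such that $\mu\ll r$ and $H(\mu\mid r)<\infty$. Set $G:=d\mu/dr$ and $$V(\mu):=\inf\bigl\{H(P\mid R):\ P \text{ a probability measure on }\Omega,\ P\circ\Pi^{-1}=\mu\bigr\}.$$ Then: (i) $V(\mu)=H(\mu\mid r)$. (ii) There exists a unique minimiser $P^*$, and it is given by $\dfrac{dP^*}{dR}=G(\Pi)$; in particular $P^*\circ\Pi^{-1}=\mu$. (iii) The density process of $P^*$ with respect to $R$ is the nonnegative $R$-martingale $M_t:=E_R[G(\Pi)\mid\mathcal F_t]$, $0\le t\le T$, so that $M_T=dP^*/dR$ and $P^*=M_T\,R$.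
   Context: $H(P\mid R)=E_P[\log(dP/dR)]$ if $P\ll R$ and $+\infty$ otherwise denotes relative entropy (for probability measures on any measurable space). *)

theory Defs
  imports "HOL-Probability.Probability"
begin

text \<open>A real-valued version of the Radon--Nikodym derivative \<open>dP/dR\<close>; for
  \<open>P \<lless> R\<close> probability measures, \<^const>\<open>RN_deriv\<close> is finite almost everywhere.\<close>

definition rn_density :: "'a measure \<Rightarrow> 'a measure \<Rightarrow> 'a \<Rightarrow> real" where
  "rn_density R P x = enn2real (RN_deriv R P x)"

text \<open>The expectation as positive part minus negative part in the extended reals. It is only used
  for \<open>ln (dP/dR)\<close> under \<open>P\<close>, whose negative part always has finite integral, so that
  \<open>\<infinity> - \<infinity>\<close> does not occur.\<close>

definition ext_expectation :: "'a measure \<Rightarrow> ('a \<Rightarrow> real) \<Rightarrow> ereal" where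
  "ext_expectation P f =
     enn2ereal (\<integral>\<^sup>+ x. ennreal (f x) \<partial>P) - enn2ereal (\<integral>\<^sup>+ x. ennreal (- f x) \<partial>P)"

definition rel_entropy :: "'a measure \<Rightarrow> 'a measure \<Rightarrow> ereal" where
  "rel_entropy P R =
     (if absolutely_continuous R P then ext_expectation P (\<lambda>x. ln (rn_density R P x)) else \<infinity>)"

text \<open>\<open>C([0,T]; \<real>\<^sup>d)\<close> with the \<open>\<sigma>\<close>-algebra generated by the coordinates (which is the Borel
  \<open>\<sigma>\<close>-algebra of the uniform topology). Paths are extensional, i.e. \<^const>\<open>undefined\<close> outside
  \<open>[0,T]\<close>, so equality of paths is equality on \<open>[0,T]\<close>.\<close>

definition path_space :: "real \<Rightarrow> (real \<Rightarrow> real ^ 'd) measure" where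
  "path_space T = restrict_space (\<Pi>\<^sub>M s\<in>{0..T}. borel) {\<omega>. continuous_on {0..T} \<omega>}"

definition canonical_filtration :: "real \<Rightarrow> real \<Rightarrow> (real \<Rightarrow> real ^ 'd) measure" where
  "canonical_filtration T u = sigma (space (path_space T))
     {(\<lambda>\<omega>. \<omega> s) -` A \<inter> space (path_space T) | s A. s \<in> {0..u} \<and> A \<in> sets borel}"

text \<open>\<open>(\<real>\<^sup>d)\<^bsup>N+1\<^esup>\<close>, as extensional functions on \<open>{0, \<dots>, N}\<close>.\<close>

definition grid_space :: "nat \<Rightarrow> (nat \<Rightarrow> real ^ 'd) measure" where
  "grid_space N = (\<Pi>\<^sub>M i\<in>{..N}. borel)"

definition grid_proj :: "(nat \<Rightarrow> real) \<Rightarrow> nat \<Rightarrow> (real \<Rightarrow> real ^ 'd) \<Rightarrow> nat \<Rightarrow> real ^ 'd" where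
  "grid_proj t N \<omega> = (\<lambda>i\<in>{..N}. \<omega> (t i))"

definition admissible ::
  "real \<Rightarrow> (nat \<Rightarrow> real) \<Rightarrow> nat \<Rightarrow> (nat \<Rightarrow> real ^ 'd) measure \<Rightarrow> (real \<Rightarrow> real ^ 'd) measure set" where
  "admissible T t N \<mu> = {P. prob_space P \<and> sets P = sets (path_space T) \<and>
     distr P (grid_space N) (grid_proj t N) = \<mu>}"

definition entropy_value ::
  "real \<Rightarrow> (nat \<Rightarrow> real) \<Rightarrow> nat \<Rightarrow> (real \<Rightarrow> real ^ 'd) measure \<Rightarrow> (nat \<Rightarrow> real ^ 'd) measure \<Rightarrow> ereal" where
  "entropy_value T t N R \<mu> = (INF P \<in> admissible T t N \<mu>. rel_entropy P R)"

definition is_minimiser ::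
  "real \<Rightarrow> (nat \<Rightarrow> real) \<Rightarrow> nat \<Rightarrow> (real \<Rightarrow> real ^ 'd) measure \<Rightarrow> (nat \<Rightarrow> real ^ 'd) measure
     \<Rightarrow> (real \<Rightarrow> real ^ 'd) measure \<Rightarrow> bool" where
  "is_minimiser T t N R \<mu> P \<longleftrightarrow>
     P \<in> admissible T t N \<mu> \<and> rel_entropy P R = entropy_value T t N R \<mu>"

definition martingale_on ::
  "'a measure \<Rightarrow> real set \<Rightarrow> (real \<Rightarrow> 'a measure) \<Rightarrow> (real \<Rightarrow> 'a \<Rightarrow> real) \<Rightarrow> bool" where
  "martingale_on R I F M \<longleftrightarrow>
     (\<forall>u\<in>I. subalgebra R (F u) \<and> M u \<in> borel_measurable (F u) \<and> integrable R (M u)) \<and>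
     (\<forall>s\<in>I. \<forall>u\<in>I. s \<le> u \<longrightarrow>
        sets (F s) \<subseteq> sets (F u) \<and> (AE \<omega> in R. real_cond_exp R (F s) (M u) \<omega> = M s \<omega>))"

text \<open>\<open>Z u\<close> is a version of the derivative of \<open>P\<close> restricted to \<open>F u\<close> with respect to \<open>R\<close> restricted
  to \<open>F u\<close>. Nonnegativity is stated separately because \<^const>\<open>ennreal\<close> truncates at \<open>0\<close>.\<close>

definition density_process ::
  "'a measure \<Rightarrow> 'a measure \<Rightarrow> real set \<Rightarrow> (real \<Rightarrow> 'a measure) \<Rightarrow> (real \<Rightarrow> 'a \<Rightarrow> real) \<Rightarrow> bool" where
  "density_process R P I F Z \<longleftrightarrow>
     (\<forall>u\<in>I. Z u \<in> borel_measurable (F u) \<and> (AE \<omega> in R. 0 \<le> Z u \<omega>) \<and>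
        restr_to_subalg P (F u) = density (restr_to_subalg R (F u)) (\<lambda>\<omega>. ennreal (Z u \<omega>)))"

end

theory Submission
  imports Defs
begin

text \<open>If \<open>P \<lless> R\<close> has density \<open>f\<close> and pushes forward to \<open>\<mu>\<close> under \<open>\<Pi>\<close>, then \<open>E\<^sub>P[ln G(\<Pi>)]\<close> is an
  integral with respect to \<open>\<mu>\<close> alone, namely \<open>H(\<mu> | r)\<close>, whatever the choice of \<open>P\<close>. Hence
  \<open>H(P | R) - H(\<mu> | r) = E\<^sub>P[ln f - ln G(\<Pi>)]\<close>, which by Gibbs' inequality is nonnegative and
  vanishes only if \<open>f = G(\<Pi>)\<close>. Path space plays no role until the conditional expectations are
  taken; there, \<open>\<Pi>\<close> is measurable with respect to the terminal \<open>\<sigma>\<close>-algebra.\<close>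

section \<open>Radon--Nikodym densities and relative entropy\<close>

lemma rn_density_nonneg: "0 \<le> rn_density R P x"
  by (simp add: rn_density_def)

lemma borel_measurable_rn_density [measurable]: "rn_density R P \<in> borel_measurable R"
  unfolding rn_density_def by measurable

text \<open>\<open>enn2real\<close> sends an infinite derivative to 0; finiteness of
  \<open>P\<close> makes the derivative finite a.e., so nothing is lost.\<close>

lemma (in sigma_finite_measure) density_rn_density:
  assumes "absolutely_continuous M P" "sets P = sets M" "finite_measure P"
  shows "density M (\<lambda>x. ennreal (rn_density M P x)) = P"
proof -
  interpret P: finite_measure P by fact
  have "AE x in M. RN_deriv M P x \<noteq> \<infinity>"
    by (rule RN_deriv_finite) (use assms in \<open>auto intro: P.sigma_finite_measure_axioms\<close>)
  then have "AE x in M. ennreal (rn_density M P x) = RN_deriv M P x"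
    by eventually_elim (simp add: rn_density_def less_top)
  then have "density M (\<lambda>x. ennreal (rn_density M P x)) = density M (RN_deriv M P)"
    by (intro density_cong) auto
  with assms show ?thesis by (simp add: density_RN_deriv)
qed

lemma (in sigma_finite_measure) rn_density_density:
  fixes f :: "'a \<Rightarrow> real"
  assumes [measurable]: "f \<in> borel_measurable M" and "\<And>x. 0 \<le> f x"
  shows "AE x in M. rn_density M (density M (\<lambda>x. ennreal (f x))) x = f x"
proof -
  have "AE x in M. ennreal (f x) = RN_deriv M (density M (\<lambda>x. ennreal (f x))) x"
    by (rule RN_deriv_unique) auto
  then show ?thesis
    by eventually_elim (metis rn_density_def enn2real_ennreal assms(2))
qed

lemma prob_density_integral:
  fixes f :: "'a \<Rightarrow> real"
  assumes [measurable]: "f \<in> borel_measurable R" and "\<And>x. 0 \<le> f x"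
    and "prob_space (density R (\<lambda>x. ennreal (f x)))"
  shows "integrable R f" "integral\<^sup>L R f = 1"
proof -
  have "(\<integral>\<^sup>+x. ennreal (f x) \<partial>R) = emeasure (density R (\<lambda>x. ennreal (f x))) (space R)"
    by (simp add: emeasure_density cong: nn_integral_cong)
  also have "\<dots> = 1"
    using prob_space.emeasure_space_1[OF assms(3)] by simp
  finally have 1: "(\<integral>\<^sup>+x. ennreal (f x) \<partial>R) = 1" .
  show "integrable R f"
    by (rule integrableI_nonneg) (use assms 1 in auto)
  show "integral\<^sup>L R f = 1"
    using 1 assms by (subst integral_eq_nn_integral) auto
qed

text \<open>Where \<open>f x \<le> 0\<close> the truncated density is 0, so that set is null. This
  keeps the logarithms below at positive arguments.\<close>

lemma prob_density_pos_AE: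
  fixes f :: "'a \<Rightarrow> real"
  assumes [measurable]: "f \<in> borel_measurable R"
  shows "AE x in density R (\<lambda>x. ennreal (f x)). 0 < f x"
  by (subst AE_density) auto

text \<open>Pointwise \<open>- f ln f \<le> 1\<close>, from \<open>ln y \<le> y - 1\<close> at
  \<open>y = 1 / f\<close>. This bound excludes the indeterminate difference in
  \<open>ext_expectation\<close>.\<close>

lemma nn_integral_neg_ln_density_le:
  fixes f :: "'a \<Rightarrow> real"
  assumes "prob_space R" and [measurable]: "f \<in> borel_measurable R" and f: "\<And>x. 0 \<le> f x"
  shows "(\<integral>\<^sup>+x. ennreal (- ln (f x)) \<partial>density R (\<lambda>x. ennreal (f x))) \<le> 1"
proof -
  have le: "f x * (- ln (f x)) \<le> 1" for x
  proof (cases "f x = 0")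
    case False
    with f[of x] have pos: "0 < f x" by simp
    with ln_le_minus_one[of "1 / f x"] have "- ln (f x) \<le> 1 / f x - 1"
      by (simp add: ln_div)
    with pos have "f x * (- ln (f x)) \<le> f x * (1 / f x - 1)"
      by (intro mult_left_mono) auto
    also have "\<dots> \<le> 1" using pos by (simp add: algebra_simps)
    finally show ?thesis .
  qed simp
  have "(\<integral>\<^sup>+x. ennreal (- ln (f x)) \<partial>density R (\<lambda>x. ennreal (f x)))
      = (\<integral>\<^sup>+x. ennreal (f x * (- ln (f x))) \<partial>R)"
    by (subst nn_integral_density) (auto simp: f simp flip: ennreal_mult')
  also have "\<dots> \<le> (\<integral>\<^sup>+x. 1 \<partial>R)"
    by (rule nn_integral_mono) (metis ennreal_leI ennreal_1 le)
  also have "\<dots> = 1"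
    using prob_space.emeasure_space_1[OF assms(1)] by simp
  finally show ?thesis .
qed

lemma ext_expectation_integrable:
  assumes "integrable P f"
  shows "ext_expectation P f = ereal (integral\<^sup>L P f)"
proof -
  have fin: "(\<integral>\<^sup>+x. ennreal (f x) \<partial>P) \<noteq> \<infinity>" "(\<integral>\<^sup>+x. ennreal (- f x) \<partial>P) \<noteq> \<infinity>"
    using assms by (auto simp: real_integrable_def)
  then have "enn2ereal (\<integral>\<^sup>+x. ennreal (f x) \<partial>P) = ereal (enn2real (\<integral>\<^sup>+x. ennreal (f x) \<partial>P))"
    "enn2ereal (\<integral>\<^sup>+x. ennreal (- f x) \<partial>P) = ereal (enn2real (\<integral>\<^sup>+x. ennreal (- f x) \<partial>P))"
    by (metis enn2ereal_ennreal enn2real_nonneg ennreal_enn2real infinity_ennreal_def less_top)+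
  then show ?thesis
    by (simp add: ext_expectation_def real_lebesgue_integral_def[OF assms])
qed

text \<open>Finite entropy bounds only the difference of the positive and negative parts. The
  negative part has integral at most 1, so the positive part is finite too and the entropy is a
  genuine Bochner integral.\<close>

lemma rel_entropy_finiteD:
  assumes R: "prob_space R" and P: "prob_space P" "sets P = sets R"
    and fin: "rel_entropy P R < \<infinity>"
  shows "absolutely_continuous R P"
    and "integrable P (\<lambda>x. ln (rn_density R P x))"
    and "rel_entropy P R = ereal (\<integral>x. ln (rn_density R P x) \<partial>P)"
proof -
  interpret R: prob_space R by fact
  interpret P: prob_space P by fact
  show ac: "absolutely_continuous R P"
    using fin by (auto simp: rel_entropy_def split: if_splits)
  have [measurable]: "(\<lambda>x. ln (rn_density R P x)) \<in> borel_measurable P"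
    by (subst measurable_cong_sets[OF P(2) refl]) measurable
  have "(\<integral>\<^sup>+x. ennreal (- ln (rn_density R P x)) \<partial>P) \<le> 1"
    using nn_integral_neg_ln_density_le[OF R borel_measurable_rn_density rn_density_nonneg, of P]
    by (simp add: R.density_rn_density[OF ac P(2) P.finite_measure_axioms])
  then have neg: "(\<integral>\<^sup>+x. ennreal (- ln (rn_density R P x)) \<partial>P) < \<infinity>"
    using le_less_trans by fastforce
  then have "enn2ereal (\<integral>\<^sup>+x. ennreal (- ln (rn_density R P x)) \<partial>P) \<noteq> \<infinity>"
    using enn2ereal_eq_top_iff by (metis infinity_ennreal_def less_irrefl)
  moreover have "enn2ereal (\<integral>\<^sup>+x. ennreal (ln (rn_density R P x)) \<partial>P)
      - enn2ereal (\<integral>\<^sup>+x. ennreal (- ln (rn_density R P x)) \<partial>P) < \<infinity>"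
    using fin ac by (simp add: rel_entropy_def ext_expectation_def)
  ultimately have "enn2ereal (\<integral>\<^sup>+x. ennreal (ln (rn_density R P x)) \<partial>P) \<noteq> \<infinity>"
    by auto
  with neg show int: "integrable P (\<lambda>x. ln (rn_density R P x))"
    by (auto simp: real_integrable_def)
  show "rel_entropy P R = ereal (\<integral>x. ln (rn_density R P x) \<partial>P)"
    using ac ext_expectation_integrable[OF int] by (simp add: rel_entropy_def)
qed

text \<open>Allows any nonnegative version \<open>g\<close> of the density: it agrees with the
  chosen derivative a.e. under \<open>R\<close>, hence under the measure with density
  \<open>g\<close>.\<close>

lemma rel_entropy_density:
  fixes g :: "'a \<Rightarrow> real"
  assumes "prob_space R" and [measurable]: "g \<in> borel_measurable R" and "\<And>x. 0 \<le> g x"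
    and int: "integrable (density R (\<lambda>x. ennreal (g x))) (\<lambda>x. ln (g x))"
  shows "rel_entropy (density R (\<lambda>x. ennreal (g x))) R
    = ereal (\<integral>x. ln (g x) \<partial>density R (\<lambda>x. ennreal (g x)))"
proof -
  let ?P = "density R (\<lambda>x. ennreal (g x))"
  interpret R: prob_space R by fact
  have ac: "absolutely_continuous R ?P"
    by (rule absolutely_continuousI_density) measurable
  have "AE x in R. rn_density R ?P x = g x"
    by (rule R.rn_density_density) (use assms in auto)
  then have eq: "AE x in ?P. ln (g x) = ln (rn_density R ?P x)"
    by (subst AE_density) auto
  have int': "integrable ?P (\<lambda>x. ln (rn_density R ?P x))"
    by (rule integrable_cong_AE_imp[OF int _ eq]) measurable
  have "(\<integral>x. ln (rn_density R ?P x) \<partial>?P) = (\<integral>x. ln (g x) \<partial>?P)"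
    by (rule integral_cong_AE) (use eq in auto)
  with ac ext_expectation_integrable[OF int'] show ?thesis
    by (simp add: rel_entropy_def)
qed

section \<open>Gibbs' inequality with its equality case\<close>

text \<open>Integrate \<open>ln y \<le> y - 1\<close> at \<open>y = g / f\<close> against
  \<open>P\<close>; the right side has integral at most 0. Since \<open>ln y = y - 1\<close> forces
  \<open>y = 1\<close>, equality of the integrals forces \<open>f = g\<close> a.e. under
  \<open>P\<close>.\<close>

lemma
  fixes f g :: "'a \<Rightarrow> real"
  assumes [measurable]: "f \<in> borel_measurable R" "g \<in> borel_measurable R"
    and nn: "\<And>x. 0 \<le> f x" "\<And>x. 0 \<le> g x"
    and P_def: "P = density R (\<lambda>x. ennreal (f x))" and P: "prob_space P"
    and Q: "prob_space (density R (\<lambda>x. ennreal (g x)))"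
    and gpos: "AE x in P. 0 < g x"
    and int: "integrable P (\<lambda>x. ln (f x))" "integrable P (\<lambda>x. ln (g x))"
  shows gibbs_inequality: "(\<integral>x. ln (g x) \<partial>P) \<le> (\<integral>x. ln (f x) \<partial>P)"
    and gibbs_inequality_eqD: "(\<integral>x. ln (f x) \<partial>P) \<le> (\<integral>x. ln (g x) \<partial>P) \<Longrightarrow> AE x in R. f x = g x"
proof -
  interpret P: prob_space P by fact
  have sP [measurable_cong]: "sets P = sets R" by (simp add: P_def)
  note f1 = prob_density_integral[OF assms(1) nn(1) P[unfolded P_def]]
  note g1 = prob_density_integral[OF assms(2) nn(2) Q]
  have fpos: "AE x in P. 0 < f x"
    unfolding P_def by (rule prob_density_pos_AE) measurable
  \<comment> \<open>Division by zero gives 0, so the product is \<open>g x\<close> where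
    \<open>f x > 0\<close> and 0 elsewhere. The mass of \<open>g\<close> on the zero set of
    \<open>f\<close> is lost, which is why \<open>q1\<close> is only an inequality.\<close>
  have bound: "f x * (g x / f x) \<le> g x" "0 \<le> f x * (g x / f x)" for x
    using nn[of x] by (cases "f x = 0"; auto)+
  have intR: "integrable R (\<lambda>x. f x * (g x / f x))"
    by (rule Bochner_Integration.integrable_bound[OF g1(1)])
       (use bound nn in \<open>auto simp del: times_divide_eq_right intro!: AE_I2\<close>)
  have intq: "integrable P (\<lambda>x. g x / f x)"
    unfolding P_def by (subst integrable_density) (use intR nn in auto)
  have "(\<integral>x. g x / f x \<partial>P) = (\<integral>x. f x * (g x / f x) \<partial>R)"
    unfolding P_def by (subst integral_density) (use nn in auto)
  also have "\<dots> \<le> (\<integral>x. g x \<partial>R)"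
    by (rule integral_mono[OF intR g1(1)]) (rule bound)
  finally have q1: "(\<integral>x. g x / f x \<partial>P) \<le> 1" using g1(2) by simp
  \<comment> \<open>The gap in \<open>ln y \<le> y - 1\<close> at \<open>y = g / f\<close>, with the
    logarithm split so that its integrability follows from \<open>int\<close> and
    \<open>intq\<close>.\<close>
  define d where "d x = ln (f x) - ln (g x) + (g x / f x - 1)" for x
  have ln_quot: "AE x in P. d x = (g x / f x - 1) - ln (g x / f x) \<and> 0 < g x / f x"
    using fpos gpos by eventually_elim (auto simp: d_def ln_div)
  then have d0: "AE x in P. 0 \<le> d x"
    by eventually_elim (use ln_le_minus_one in fastforce)
  have intd: "integrable P d"
    unfolding d_def using int intq by auto
  have "integral\<^sup>L P d = (\<integral>x. ln (f x) \<partial>P) - (\<integral>x. ln (g x) \<partial>P) + ((\<integral>x. g x / f x \<partial>P) - 1)"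
    unfolding d_def using int intq by (simp add: P.prob_space)
  with q1 have d_le: "integral\<^sup>L P d \<le> (\<integral>x. ln (f x) \<partial>P) - (\<integral>x. ln (g x) \<partial>P)" by simp
  have d_nn: "0 \<le> integral\<^sup>L P d" by (rule integral_nonneg_AE[OF d0])
  from d_le d_nn show "(\<integral>x. ln (g x) \<partial>P) \<le> (\<integral>x. ln (f x) \<partial>P)" by simp
  assume "(\<integral>x. ln (f x) \<partial>P) \<le> (\<integral>x. ln (g x) \<partial>P)"
  with d_le d_nn have "integral\<^sup>L P d = 0" by simp
  then have "AE x in P. d x = 0"
    using integral_nonneg_eq_0_iff_AE[OF intd d0] by simp
  with ln_quot fpos have "AE x in P. f x = g x"
  proof eventually_elim
    case (elim x)
    then have "g x / f x = 1" by (intro ln_eq_minus_one) auto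
    with elim show ?case by (simp add: field_simps)
  qed
  then have "AE x in R. 0 < f x \<longrightarrow> f x = g x"
    unfolding P_def by (subst (asm) AE_density) auto
  then have le: "AE x in R. f x \<le> g x"
    by eventually_elim (metis nn order_le_less)
  \<comment> \<open>\<open>f = g\<close> is so far only known where \<open>f > 0\<close>; equality of the total masses covers the rest.\<close>
  show "AE x in R. f x = g x"
    using integral_ineq_eq_0_then_AE[OF le f1(1) g1(1)] f1(2) g1(2) by auto
qed

section \<open>Entropy minimisation under a pushforward constraint\<close>

text \<open>Abstract form of the problem: \<open>\<Phi>\<close> will be \<open>grid_proj t N\<close>
  and \<open>S\<close> will be \<open>grid_space N\<close>. \<open>G\<close> is a parameter with a
  defining equation, so that a given \<open>G\<close> can be supplied directly.\<close>

locale pushforward_constraint = R: prob_space R + \<mu>: prob_space \<mu>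
  for R :: "'a measure" and \<mu> :: "'b measure" +
  fixes \<Phi> :: "'a \<Rightarrow> 'b" and S :: "'b measure" and G :: "'b \<Rightarrow> real"
  assumes \<Phi> [measurable]: "\<Phi> \<in> measurable R S"
    and sets_\<mu>: "sets \<mu> = sets S"
    and ac: "absolutely_continuous (distr R S \<Phi>) \<mu>"
    and finite_entropy: "rel_entropy \<mu> (distr R S \<Phi>) < \<infinity>"
    and G_def: "G = rn_density (distr R S \<Phi>) \<mu>"
begin

definition minimiser :: "'a measure" where
  "minimiser = density R (\<lambda>x. ennreal (G (\<Phi> x)))"

lemma G_nonneg: "0 \<le> G y"
  by (simp add: G_def rn_density_nonneg)

lemma G_measurable [measurable]: "G \<in> borel_measurable S"
  using borel_measurable_rn_density[of "distr R S \<Phi>" \<mu>] by (simp add: G_def)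

lemma prob_space_pushforward: "prob_space (distr R S \<Phi>)"
  by (rule R.prob_space_distr) measurable

lemma \<mu>_eq: "\<mu> = density (distr R S \<Phi>) (\<lambda>y. ennreal (G y))"
proof -
  interpret r: prob_space "distr R S \<Phi>" by (rule prob_space_pushforward)
  show ?thesis
    unfolding G_def by (rule r.density_rn_density[symmetric])
      (use ac sets_\<mu> \<mu>.finite_measure_axioms in auto)
qed

text \<open>The density depends on \<open>x\<close> only through \<open>\<Phi> x\<close>, so by
  change of variables the pushforward is the pushforward of \<open>R\<close> reweighted by
  \<open>G\<close>, which is \<open>\<mu>\<close>.\<close>

lemma distr_minimiser: "distr minimiser S \<Phi> = \<mu>"
proof (rule measure_eqI)
  fix A assume "A \<in> sets (distr minimiser S \<Phi>)"
  then have [measurable]: "A \<in> sets S" by simp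
  have [measurable]: "\<Phi> \<in> measurable minimiser S" by (simp add: minimiser_def)
  have "emeasure (distr minimiser S \<Phi>) A = emeasure minimiser (\<Phi> -` A \<inter> space R)"
    by (subst emeasure_distr) (auto simp: minimiser_def)
  also have "\<dots> = (\<integral>\<^sup>+x. ennreal (G (\<Phi> x)) * indicator (\<Phi> -` A \<inter> space R) x \<partial>R)"
    unfolding minimiser_def by (rule emeasure_density) measurable
  also have "\<dots> = (\<integral>\<^sup>+x. ennreal (G (\<Phi> x)) * indicator A (\<Phi> x) \<partial>R)"
    by (rule nn_integral_cong) (auto simp: indicator_def)
  also have "\<dots> = (\<integral>\<^sup>+y. ennreal (G y) * indicator A y \<partial>distr R S \<Phi>)"
    by (subst nn_integral_distr) auto
  also have "\<dots> = emeasure (density (distr R S \<Phi>) (\<lambda>y. ennreal (G y))) A"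
    by (subst emeasure_density) auto
  finally show "emeasure (distr minimiser S \<Phi>) A = emeasure \<mu> A"
    using \<mu>_eq by simp
qed (simp add: sets_\<mu>)

text \<open>A pushforward preserves total mass, and here it is the probability measure
  \<open>\<mu>\<close>.\<close>

lemma prob_space_minimiser: "prob_space minimiser"
proof (rule prob_space_distrD)
  show "\<Phi> \<in> measurable minimiser S" by (simp add: minimiser_def)
  show "prob_space (distr minimiser S \<Phi>)"
    by (simp add: distr_minimiser \<mu>.prob_space_axioms)
qed

lemma integrable_G: "integrable R (\<lambda>x. G (\<Phi> x))"
  using prob_density_integral(1)[of "\<lambda>x. G (\<Phi> x)" R] prob_space_minimiser G_nonneg
  by (simp add: minimiser_def)

text \<open>Each claim is a fact about \<open>G\<close> under \<open>\<mu>\<close>, carried back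
  along \<open>\<Phi>\<close> by change of variables. The last one supplies the hypothesis
  \<open>gpos\<close> of Gibbs' inequality.\<close>

lemma
  assumes P: "sets P = sets R" "distr P S \<Phi> = \<mu>"
  shows integrable_ln_G: "integrable P (\<lambda>x. ln (G (\<Phi> x)))"
    and integral_ln_G: "rel_entropy \<mu> (distr R S \<Phi>) = ereal (\<integral>x. ln (G (\<Phi> x)) \<partial>P)"
    and G_pos_AE: "AE x in P. 0 < G (\<Phi> x)"
proof -
  note H = rel_entropy_finiteD[OF prob_space_pushforward \<mu>.prob_space_axioms _ finite_entropy,
      folded G_def]
  have [measurable]: "\<Phi> \<in> measurable P S"
    using \<Phi> P(1) by (simp cong: measurable_cong_sets)
  have "integrable (distr P S \<Phi>) (\<lambda>y. ln (G y))"
    using H(2) sets_\<mu> by (simp add: P(2))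
  then show "integrable P (\<lambda>x. ln (G (\<Phi> x)))"
    by (subst (asm) integrable_distr_eq) auto
  show "rel_entropy \<mu> (distr R S \<Phi>) = ereal (\<integral>x. ln (G (\<Phi> x)) \<partial>P)"
    using H(3) sets_\<mu> by (simp add: P(2)[symmetric] integral_distr)
  have "AE y in \<mu>. 0 < G y"
    by (subst \<mu>_eq, rule prob_density_pos_AE) simp
  then show "AE x in P. 0 < G (\<Phi> x)"
    by (subst (asm) P(2)[symmetric], subst (asm) AE_distr_iff) auto
qed

text \<open>The log density of \<open>minimiser\<close> is itself \<open>ln (G (\<Phi> x))\<close>,
  so its entropy is the integral computed in \<open>integral_ln_G\<close>.\<close>

lemma rel_entropy_minimiser: "rel_entropy minimiser R = rel_entropy \<mu> (distr R S \<Phi>)"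
proof -
  have s: "sets minimiser = sets R" by (simp add: minimiser_def)
  show ?thesis
    unfolding integral_ln_G[OF s distr_minimiser] minimiser_def
    by (rule rel_entropy_density)
       (use R.prob_space_axioms G_nonneg integrable_ln_G[OF s distr_minimiser]
         in \<open>auto simp: minimiser_def\<close>)
qed

text \<open>Gibbs' inequality compares \<open>rn_density R P\<close> with the density of
  \<open>minimiser\<close>; its equality case gives uniqueness. An infinite entropy makes the lower
  bound trivial.\<close>

lemma
  assumes P: "prob_space P" "sets P = sets R" "distr P S \<Phi> = \<mu>"
  shows rel_entropy_ge: "rel_entropy \<mu> (distr R S \<Phi>) \<le> rel_entropy P R"
    and rel_entropy_le_imp_eq:
      "rel_entropy P R \<le> rel_entropy \<mu> (distr R S \<Phi>) \<Longrightarrow> P = minimiser"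
proof -
  interpret P: prob_space P by fact
  note H = rel_entropy_finiteD[OF R.prob_space_axioms P(1,2)]
  have eq: "P = density R (\<lambda>x. ennreal (rn_density R P x))" if "rel_entropy P R < \<infinity>"
    using R.density_rn_density[OF H(1)[OF that] P(2) P.finite_measure_axioms] by simp
  \<comment> \<open>The premises of Gibbs' inequality in order. \<open>eq\<close> and
    \<open>H(2)\<close> still carry the assumption \<open>rel_entropy P R < \<infinity>\<close>,
    which is discharged at each use.\<close>
  note gibbs = borel_measurable_rn_density measurable_compose[OF \<Phi> G_measurable]
    rn_density_nonneg G_nonneg eq P(1) prob_space_minimiser[unfolded minimiser_def]
    G_pos_AE[OF P(2,3)] H(2) integrable_ln_G[OF P(2,3)]
  show "rel_entropy \<mu> (distr R S \<Phi>) \<le> rel_entropy P R"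
  proof (cases "rel_entropy P R < \<infinity>")
    case True
    then show ?thesis
      using gibbs_inequality[OF gibbs] by (simp add: integral_ln_G[OF P(2,3)] H(3))
  qed simp
  assume le: "rel_entropy P R \<le> rel_entropy \<mu> (distr R S \<Phi>)"
  then have fin: "rel_entropy P R < \<infinity>"
    using finite_entropy by (rule le_less_trans)
  have "AE x in R. rn_density R P x = G (\<Phi> x)"
    using gibbs_inequality_eqD[OF gibbs] fin le by (simp add: integral_ln_G[OF P(2,3)] H(3))
  then have "density R (\<lambda>x. ennreal (rn_density R P x)) = minimiser"
    unfolding minimiser_def by (intro density_cong) auto
  with eq[OF fin] show "P = minimiser" by simp
qed

end

section \<open>Density processes as conditional expectations\<close>

text \<open>This is the tower property; finiteness of \<open>R\<close> makes its restriction to each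
  \<open>F u\<close> sigma-finite, as conditioning requires.\<close>

lemma martingale_on_real_cond_exp:
  assumes "finite_measure R" and sub: "\<And>u. u \<in> I \<Longrightarrow> subalgebra R (F u)"
    and mono: "\<And>s u. s \<in> I \<Longrightarrow> u \<in> I \<Longrightarrow> s \<le> u \<Longrightarrow> sets (F s) \<subseteq> sets (F u)"
    and h: "integrable R h"
  shows "martingale_on R I F (\<lambda>u. real_cond_exp R (F u) h)"
  unfolding martingale_on_def
proof (intro conjI ballI impI)
  interpret R: finite_measure R by fact
  have sf: "sigma_finite_subalgebra R (F u)" if "u \<in> I" for u
  proof -
    interpret finite_measure_subalgebra R "F u" by unfold_locales (rule sub[OF that])
    show ?thesis by unfold_locales
  qed
  fix s u assume s: "s \<in> I" and u: "u \<in> I" and "s \<le> u"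
  then show sets: "sets (F s) \<subseteq> sets (F u)" by (intro mono)
  have "subalgebra (F u) (F s)"
    using sub[OF s] sub[OF u] sets by (simp add: subalgebra_def)
  then show "AE \<omega> in R. real_cond_exp R (F s) (real_cond_exp R (F u) h) \<omega> = real_cond_exp R (F s) h \<omega>"
    by (intro sigma_finite_subalgebra.real_cond_exp_nested_subalg sf s sub u h)
next
  fix u assume u: "u \<in> I"
  show "subalgebra R (F u)" by (rule sub[OF u])
  interpret R: finite_measure R by fact
  interpret finite_measure_subalgebra R "F u" by unfold_locales (rule sub[OF u])
  show "real_cond_exp R (F u) h \<in> borel_measurable (F u)" by simp
  show "integrable R (real_cond_exp R (F u) h)" by (rule real_cond_exp_int(1)[OF h])
qed

text \<open>On \<open>A\<close> in \<open>F\<close> this is the defining identity of conditional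
  expectation. That identity concerns Bochner integrals, so both sides pass between these and
  nonnegative integrals; for the conditional expectation, nonnegativity a.e. suffices.\<close>

lemma (in sigma_finite_subalgebra) restr_to_subalg_density:
  assumes h: "integrable M h" and nn: "\<And>x. 0 \<le> h x"
  shows "restr_to_subalg (density M (\<lambda>x. ennreal (h x))) F
    = density (restr_to_subalg M F) (\<lambda>x. ennreal (real_cond_exp M F h x))"
proof (rule measure_eqI)
  let ?P = "density M (\<lambda>x. ennreal (h x))"
  have [measurable]: "h \<in> borel_measurable M" using h by auto
  have subP: "subalgebra ?P F" using subalg by (simp add: subalgebra_def)
  show "sets (restr_to_subalg ?P F)
      = sets (density (restr_to_subalg M F) (\<lambda>x. ennreal (real_cond_exp M F h x)))"
    using subP subalg by (simp add: sets_restr_to_subalg)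
  fix A assume "A \<in> sets (restr_to_subalg ?P F)"
  then have AF [measurable]: "A \<in> sets F" by (simp add: sets_restr_to_subalg[OF subP])
  have AM [measurable]: "A \<in> sets M" using AF subalg by (auto simp: subalgebra_def)
  have pos: "AE x in M. 0 \<le> real_cond_exp M F h x"
    by (rule real_cond_exp_pos) (use nn in auto)
  have int: "integrable M (\<lambda>x. h x * indicator A x)"
    "integrable M (\<lambda>x. real_cond_exp M F h x * indicator A x)"
    using h real_cond_exp_int(1)[OF h] by (auto intro: integrable_real_mult_indicator)
  have "emeasure (restr_to_subalg ?P F) A = emeasure ?P A"
    by (rule emeasure_restr_to_subalg[OF subP AF])
  also have "\<dots> = (\<integral>\<^sup>+x. ennreal (h x * indicator A x) \<partial>M)"
    by (subst emeasure_density) (auto intro!: nn_integral_cong simp: indicator_def)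
  also have "\<dots> = ennreal (\<integral>x. h x * indicator A x \<partial>M)"
    by (rule nn_integral_eq_integral[OF int(1)]) (use nn in auto)
  also have "(\<integral>x. h x * indicator A x \<partial>M) = (\<integral>x. real_cond_exp M F h x * indicator A x \<partial>M)"
    using real_cond_exp_intA[OF h AF] by (simp add: set_lebesgue_integral_def mult.commute)
  also have "ennreal \<dots> = (\<integral>\<^sup>+x. ennreal (real_cond_exp M F h x * indicator A x) \<partial>M)"
    by (rule nn_integral_eq_integral[OF int(2), symmetric]) (use pos in auto)
  also have "\<dots> = (\<integral>\<^sup>+x. ennreal (real_cond_exp M F h x) * indicator A x \<partial>M)"
    by (auto intro!: nn_integral_cong simp: indicator_def)
  also have "\<dots> = (\<integral>\<^sup>+x. ennreal (real_cond_exp M F h x) * indicator A x \<partial>restr_to_subalg M F)"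
    by (rule nn_integral_subalgebra2[OF subalg, symmetric]) measurable
  also have "\<dots> = emeasure (density (restr_to_subalg M F) (\<lambda>x. ennreal (real_cond_exp M F h x))) A"
    by (rule emeasure_density[symmetric])
       (use AF in \<open>auto simp: sets_restr_to_subalg[OF subalg] intro!: measurable_in_subalg[OF subalg]\<close>)
  finally show "emeasure (restr_to_subalg ?P F) A
    = emeasure (density (restr_to_subalg M F) (\<lambda>x. ennreal (real_cond_exp M F h x))) A" .
qed

section \<open>The canonical filtration\<close>

lemma path_space_coordinate_measurable:
  "s \<in> {0..T} \<Longrightarrow> (\<lambda>\<omega>. \<omega> s) \<in> borel_measurable (path_space T)"
  unfolding path_space_def
  by (intro measurable_restrict_space1 measurable_component_singleton)

lemma space_canonical_filtration: "space (canonical_filtration T u) = space (path_space T)"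
  unfolding canonical_filtration_def by (rule space_measure_of) auto

lemma sets_canonical_filtration:
  "sets (canonical_filtration T u) = sigma_sets (space (path_space T))
     {(\<lambda>\<omega>. \<omega> s) -` A \<inter> space (path_space T) | s A. s \<in> {0..u} \<and> A \<in> sets borel}"
  unfolding canonical_filtration_def by (rule sets_measure_of) auto

lemma sets_canonical_filtration_mono:
  "s \<le> u \<Longrightarrow> sets (canonical_filtration T s) \<subseteq> sets (canonical_filtration T u)"
  unfolding sets_canonical_filtration by (rule sigma_sets_mono') fastforce

lemma sets_canonical_filtration_subset:
  assumes "u \<le> T"
  shows "sets (canonical_filtration T u) \<subseteq> sets (path_space T)"
  unfolding sets_canonical_filtration
proof (rule sets.sigma_sets_subset, safe)
  fix s and A :: "(real ^ 'a) set" assume "s \<in> {0..u}" "A \<in> sets borel"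
  with assms show "(\<lambda>\<omega>. \<omega> s) -` A \<inter> space (path_space T) \<in> sets (path_space T)"
    by (intro measurable_sets[OF path_space_coordinate_measurable]) auto
qed

text \<open>If the grid lies in \<open>{0..u}\<close>, preimages under its coordinates are
  generators of the filtration at \<open>u\<close>. The case \<open>u = T\<close> gives both
  measurability under \<open>R\<close> and the terminal value of the martingale.\<close>

lemma grid_proj_measurable:
  assumes "\<And>i. i \<le> N \<Longrightarrow> t i \<in> {0..u}"
  shows "grid_proj t N \<in> measurable (canonical_filtration T u) (grid_space N)"
  unfolding grid_proj_def grid_space_def
proof (rule measurable_restrict)
  fix i assume "i \<in> {..N}"
  with assms have ti: "t i \<in> {0..u}" by simp
  show "(\<lambda>\<omega> :: real \<Rightarrow> real ^ 'a. \<omega> (t i)) \<in> borel_measurable (canonical_filtration T u)"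
  proof (rule measurableI)
    fix A :: "(real ^ 'a) set" assume "A \<in> sets borel"
    with ti show "(\<lambda>\<omega>. \<omega> (t i)) -` A \<inter> space (canonical_filtration T u) \<in> sets (canonical_filtration T u)"
      unfolding sets_canonical_filtration space_canonical_filtration
      by (intro sigma_sets.Basic) auto
  qed simp
qed

section \<open>Transfer of the abstract minimisation result to path space\<close>

theorem theorem1:
  fixes T :: real and N :: nat and t :: "nat \<Rightarrow> real"
    and R :: "(real \<Rightarrow> real ^ 'd) measure"
    and r \<mu> :: "(nat \<Rightarrow> real ^ 'd) measure"
    and G :: "(nat \<Rightarrow> real ^ 'd) \<Rightarrow> real"
    and M :: "real \<Rightarrow> (real \<Rightarrow> real ^ 'd) \<Rightarrow> real"
  assumes "1 \<le> N" and "t 0 = 0" and "\<forall>i<N. t i < t (Suc i)" and "t N = T"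
    and "prob_space R" and "sets R = sets (path_space T)"
    and r: "r = distr R (grid_space N) (grid_proj t N)"
    and "prob_space \<mu>" and "sets \<mu> = sets (grid_space N)"
    and "absolutely_continuous r \<mu>" and "rel_entropy \<mu> r < \<infinity>"
    and G: "G = rn_density r \<mu>"
    and M: "M = (\<lambda>u. real_cond_exp R (canonical_filtration T u) (\<lambda>\<omega>. G (grid_proj t N \<omega>)))"
  shows "entropy_value T t N R \<mu> = rel_entropy \<mu> r \<and>
    (\<exists>Pstar. is_minimiser T t N R \<mu> Pstar \<and>
       (\<forall>Q. is_minimiser T t N R \<mu> Q \<longrightarrow> Q = Pstar) \<and>
       absolutely_continuous R Pstar \<and>
       (AE \<omega> in R. rn_density R Pstar \<omega> = G (grid_proj t N \<omega>)) \<and>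
       Pstar = density R (\<lambda>\<omega>. ennreal (G (grid_proj t N \<omega>))) \<and>
       distr Pstar (grid_space N) (grid_proj t N) = \<mu> \<and>
       martingale_on R {0..T} (canonical_filtration T) M \<and>
       (\<forall>u\<in>{0..T}. AE \<omega> in R. 0 \<le> M u \<omega>) \<and>
       density_process R Pstar {0..T} (canonical_filtration T) M \<and>
       (AE \<omega> in R. M T \<omega> = rn_density R Pstar \<omega>) \<and>
       Pstar = density R (\<lambda>\<omega>. ennreal (M T \<omega>)))"
proof -
  interpret R: prob_space R by fact
  have "t i \<le> t j" if "i \<le> j" "j \<le> N" for i j
    using that assms(3) by (induction j rule: dec_induct) (auto simp: Suc_le_eq intro: order_trans[OF _ less_imp_le])
  \<comment> \<open>Monotonicity puts every grid time between \<open>t 0 = 0\<close> and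
    \<open>t N = T\<close>.\<close>
  from this[of 0] this[of _ N] have grid: "t i \<in> {0..T}" if "i \<le> N" for i
    using that assms(2,4) by auto
  have "0 \<le> T" using grid[of N] assms(4) by simp
  have sub: "subalgebra R (canonical_filtration T u)" if "u \<in> {0..T}" for u
    using that sets_canonical_filtration_subset[of u T] assms(6) sets_eq_imp_space_eq[OF assms(6)]
    by (auto simp: subalgebra_def space_canonical_filtration)
  have F_T: "grid_proj t N \<in> measurable (canonical_filtration T T) (grid_space N)"
    using grid by (rule grid_proj_measurable)
  interpret \<mu>: prob_space \<mu> by fact
  interpret pushforward_constraint R \<mu> "grid_proj t N" "grid_space N" G
  proof unfold_locales
    show "grid_proj t N \<in> measurable R (grid_space N)"
      using \<open>0 \<le> T\<close> by (intro measurable_from_subalg[OF sub F_T]) auto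
  qed (use assms(9-12) in \<open>simp_all add: r\<close>)
  note M' = M[THEN fun_cong]
  have sf: "sigma_finite_subalgebra R (canonical_filtration T u)" if "u \<in> {0..T}" for u
  proof -
    interpret finite_measure_subalgebra R "canonical_filtration T u"
      by unfold_locales (rule sub[OF that])
    show ?thesis by unfold_locales
  qed
  have adm: "minimiser \<in> admissible T t N \<mu>"
    using prob_space_minimiser distr_minimiser assms(6) by (simp add: admissible_def minimiser_def)
  have admD: "prob_space P" "sets P = sets R" "distr P (grid_space N) (grid_proj t N) = \<mu>"
    if "P \<in> admissible T t N \<mu>" for P
    using that assms(6) by (auto simp: admissible_def)
  \<comment> \<open>The upper bound comes from the admissible \<open>minimiser\<close>, the lower
    bound from \<open>rel_entropy_ge\<close>.\<close>
  have val: "entropy_value T t N R \<mu> = rel_entropy \<mu> r"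
    unfolding entropy_value_def r
  proof (rule antisym)
    show "(INF P\<in>admissible T t N \<mu>. rel_entropy P R)
        \<le> rel_entropy \<mu> (distr R (grid_space N) (grid_proj t N))"
      using INF_lower[OF adm, of "\<lambda>P. rel_entropy P R"] by (simp add: rel_entropy_minimiser)
  qed (auto intro!: INF_greatest rel_entropy_ge dest: admD)
  have ac': "absolutely_continuous R minimiser"
    unfolding minimiser_def by (rule absolutely_continuousI_density) measurable
  have rn: "AE \<omega> in R. rn_density R minimiser \<omega> = G (grid_proj t N \<omega>)"
    unfolding minimiser_def by (rule R.rn_density_density) (use G_nonneg in auto)
  have pos: "AE \<omega> in R. 0 \<le> M u \<omega>" if "u \<in> {0..T}" for u
    unfolding M'
    by (rule sigma_finite_subalgebra.real_cond_exp_pos[OF sf[OF that]]) (use G_nonneg in auto)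
  have mart: "martingale_on R {0..T} (canonical_filtration T) M"
    unfolding M
    by (rule martingale_on_real_cond_exp)
       (auto intro: R.finite_measure_axioms sub sets_canonical_filtration_mono[THEN subsetD]
          integrable_G)
  have dens: "density_process R minimiser {0..T} (canonical_filtration T) M"
    unfolding density_process_def
  proof (intro ballI conjI)
    fix u assume u: "u \<in> {0..T}"
    show "AE \<omega> in R. 0 \<le> M u \<omega>" by (rule pos[OF u])
    show "M u \<in> borel_measurable (canonical_filtration T u)" by (simp add: M)
    show "restr_to_subalg minimiser (canonical_filtration T u)
        = density (restr_to_subalg R (canonical_filtration T u)) (\<lambda>\<omega>. ennreal (M u \<omega>))"
      unfolding M' minimiser_def
      by (rule sigma_finite_subalgebra.restr_to_subalg_density[OF sf[OF u] integrable_G G_nonneg])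
  qed
  \<comment> \<open>\<open>G (grid_proj t N \<omega>)\<close> is already measurable at time
    \<open>T\<close>, so conditioning there leaves it unchanged a.e.\<close>
  have MT: "AE \<omega> in R. M T \<omega> = G (grid_proj t N \<omega>)"
    unfolding M'
  proof (rule sigma_finite_subalgebra.real_cond_exp_F_meas[OF sf integrable_G])
    show "(\<lambda>\<omega>. G (grid_proj t N \<omega>)) \<in> borel_measurable (canonical_filtration T T)"
      using F_T G_measurable by (rule measurable_compose)
  qed (use \<open>0 \<le> T\<close> in simp)
  have [measurable]: "M T \<in> borel_measurable R"
    unfolding M by (rule borel_measurable_cond_exp2)
  have "minimiser = density R (\<lambda>\<omega>. ennreal (M T \<omega>))"
    unfolding minimiser_def using MT by (intro density_cong) auto
  moreover have "AE \<omega> in R. M T \<omega> = rn_density R minimiser \<omega>"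
    using MT rn by eventually_elim simp
  moreover have "is_minimiser T t N R \<mu> minimiser"
    using adm val rel_entropy_minimiser by (simp add: is_minimiser_def r)
  \<comment> \<open>By \<open>val\<close>, any minimiser has entropy
    \<open>rel_entropy \<mu> r\<close>, so the equality case applies.\<close>
  moreover have "Q = minimiser" if "is_minimiser T t N R \<mu> Q" for Q
    using that val by (intro rel_entropy_le_imp_eq) (auto simp: is_minimiser_def r dest: admD)
  ultimately show ?thesis
    using val ac' rn distr_minimiser mart pos dens minimiser_def by blast
qed

end
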